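(* Let $\mathcal{X},\mathcal{Y}$ be real Hilbert spaces, $f:\mathcal{X}\to\mathbb{R}$ convex and continuously differentiable, $A:\mathcal{X}\to\mathcal{Y}$ a continuous linear operator, $b\in\mathcal{Y}$, and suppose that the primal-dual solution set $\Omega$ of $\min\{f(x):Ax=b\}$ is nonempty. Let $t_0>0$, $\alpha>0$, $\theta>\frac1\alpha$, $0\le q<1$, $0<p<1-q$, $c>0$, and let $s\in\mathbb{R}$ satisfy $-2q<s\le p-2q$. Let $(x(t),\lambda(t))$, $t\ge t_0$, be a solution of $$\begin{cases}\ddot{x}(t)+\frac{\alpha}{t^q}\dot{x}(t)+t^s\left(\nabla f(x(t))+A^T\lambda(t)+\frac{c}{t^p}x(t)\right)=0,\\ \dot{\lambda}(t)-t^{q+s}\left(A(x(t)+\theta t^q\dot{x}(t))-b-\frac{c}{t^p}\lambda(t)\right)=0,\end{cases}\qquad t\ge t_0,$$ and let $(x^*,\lambda^* )$ be the minimum norm element of $\Omega$. Then, as $t\to+\infty$, $$\mathcal{L}(x(t),\lambda^* )-\mathcal{L}(x^*,\lambda^* )\le\mathcal{O}\left(\frac{1}{t^{2q+s}}\right),$$ $$|f(x(t))-f(x^* )|\le\mathcal{O}\left(\frac{1}{t^{2q+s}}\right),\quad \|Ax(t)-b\|\le\mathcal{O}\left(\frac{1}{t^{2q+s}}\right).$$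
   Context: $\|(x,\lambda)\|=\sqrt{\|x\|^2+\|\lambda\|^2}$ on $\mathcal{X}\times\mathcal{Y}$; $A^T:\mathcal{Y}\to\mathcal{X}$ is the adjoint of $A$. The Lagrangian is $\mathcal{L}(x,\lambda)=f(x)+\langle\lambda,Ax-b\rangle$. The primal-dual solution set $\Omega$ is the set of saddle points of $\mathcal{L}$, i.e. of pairs $(\hat x,\hat\lambda)\in\mathcal{X}\times\mathcal{Y}$ with $\mathcal{L}(\hat x,\lambda)\le\mathcal{L}(\hat x,\hat\lambda)\le\mathcal{L}(x,\hat\lambda)$ for all $(x,\lambda)$; equivalently $\nabla f(\hat x)+A^T\hat\lambda=0$ and $A\hat x=b$. A solution of the system is a pair $x:[t_0,+\infty)\to\mathcal{X}$ twice differentiable, $\lambda:[t_0,+\infty)\to\mathcal{Y}$ differentiable, satisfying both equations for all $t\ge t_0$. The notation $g(t)\le\mathcal{O}(h(t))$ means that there are $C>0$ and $T\ge t_0$ with $g(t)\le C\,h(t)$ for all $t\ge T$. *)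

theory Defs
  imports "HOL-Analysis.Analysis"
begin

definition lagrangian ::
    "('a::real_inner \<Rightarrow> real) \<Rightarrow> ('a \<Rightarrow> 'b::real_inner) \<Rightarrow> 'b \<Rightarrow> 'a \<Rightarrow> 'b \<Rightarrow> real"
  where "lagrangian f A b x l = f x + l \<bullet> (A x - b)"

definition saddle_points ::
    "('a::real_inner \<Rightarrow> real) \<Rightarrow> ('a \<Rightarrow> 'b::real_inner) \<Rightarrow> 'b \<Rightarrow> ('a \<times> 'b) set"
  where "saddle_points f A b =
    {(xh, lh). \<forall>x l. lagrangian f A b xh l \<le> lagrangian f A b xh lh \<and>
                     lagrangian f A b xh lh \<le> lagrangian f A b x lh}"

text \<open>
  The derivatives are taken within \<open>[t0, \<infinity>)\<close>, hence one-sided at \<open>t0\<close>; values of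
  \<open>x\<close> and \<open>l\<close> to the left of \<open>t0\<close> are irrelevant. The argument \<open>gf\<close> is the gradient of
  the objective.
\<close>

definition solves_system ::
    "('a::real_inner \<Rightarrow> 'a) \<Rightarrow> ('a \<Rightarrow> 'b::real_inner) \<Rightarrow> 'b \<Rightarrow>
     real \<Rightarrow> real \<Rightarrow> real \<Rightarrow> real \<Rightarrow> real \<Rightarrow> real \<Rightarrow> real \<Rightarrow>
     (real \<Rightarrow> 'a) \<Rightarrow> (real \<Rightarrow> 'b) \<Rightarrow> bool"
  where "solves_system gf A b \<alpha> \<theta> q p c s t0 x l \<longleftrightarrow>
    (\<exists>x' x'' l'. \<forall>t\<ge>t0.
       (x has_vector_derivative x' t) (at t within {t0..}) \<and>
       (x' has_vector_derivative x'' t) (at t within {t0..}) \<and>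
       (l has_vector_derivative l' t) (at t within {t0..}) \<and>
       x'' t + (\<alpha> / t powr q) *\<^sub>R x' t
         + (t powr s) *\<^sub>R (gf (x t) + adjoint A (l t) + (c / t powr p) *\<^sub>R x t) = 0 \<and>
       l' t - (t powr (q + s)) *\<^sub>R
         (A (x t + (\<theta> * t powr q) *\<^sub>R x' t) - b - (c / t powr p) *\<^sub>R l t) = 0)"

text \<open>
  The one-sided estimate \<open>g t \<le> O(h t)\<close> as \<open>t\<close> tends to infinity: unlike the Landau
  symbol \<open>O\<close> of the library, it does not bound \<open>g\<close> from below.
\<close>

definition le_bigo :: "real \<Rightarrow> (real \<Rightarrow> real) \<Rightarrow> (real \<Rightarrow> real) \<Rightarrow> bool"
  where "le_bigo t0 g h \<longleftrightarrow> (\<exists>C>0. \<exists>T\<ge>t0. \<forall>t\<ge>T. g t \<le> C * h t)"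

end

theory Submission
  imports Defs
begin

text \<open>
  Put \<open>\<phi> = \<L>(\<cdot>, \<lambda>*) - \<L>(x*, \<lambda>*) \<ge> 0\<close>, \<open>v = x - x* + \<theta> t\<^sup>q x'\<close> and
  \<open>k = \<theta> \<alpha> - 1 - \<theta> q t\<^bsup>q-1\<^esup>\<close>. In the derivative of the energy
  \<open>E = \<parallel>v\<parallel>\<^sup>2 / 2 + k \<parallel>x - x*\<parallel>\<^sup>2 / 2 + \<theta> \<parallel>\<lambda> - \<lambda>*\<parallel>\<^sup>2 / 2
    + \<theta>\<^sup>2 t\<^bsup>2q+s\<^esup> (\<phi>(x) + c t\<^bsup>-p\<^esup> \<parallel>x\<parallel>\<^sup>2 / 2)\<close>
  all cross terms cancel, and convexity together with \<open>2q + s \<le> p\<close> and \<open>p - s < 2\<close> yields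
  \<open>E' \<le> t\<^bsup>q+s-p\<^esup> (C - K E)\<close> for large \<open>t\<close> with some \<open>K > 0\<close>. So \<open>E\<close> cannot increase
  while it exceeds \<open>C / K\<close>; hence \<open>E\<close> is bounded, which bounds \<open>t\<^bsup>2q+s\<^esup> \<phi>(x)\<close> and \<open>\<lambda>\<close>.
  For the constraint, the derivative of \<open>u = \<theta> t\<^bsup>2q+s\<^esup> (A x - b) - \<lambda>\<close> no longer contains \<open>x'\<close>:
  \<open>u' = -(a / \<theta>) (u + \<lambda>) + c t\<^bsup>q+s-p\<^esup> \<lambda>\<close> with \<open>a = t\<^bsup>-q\<^esup> - \<theta> (2q + s) / t\<close>, so that
  \<open>\<parallel>u\<parallel>\<^sup>2\<close> is bounded by the same barrier argument.
\<close>

section \<open>Barrier principle for scalar differential inequalities\<close>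

text \<open>If \<open>E t\<close> exceeded \<open>N = max (E T) M\<close>, take the last time
  \<open>r\<close> before \<open>t\<close> with \<open>E r \<le> N\<close>. By the intermediate
  value theorem \<open>E r = N\<close>, and from \<open>r\<close> on \<open>E\<close> stays above
  \<open>M\<close>, so it cannot increase up to \<open>t\<close>, a contradiction.\<close>

lemma deriv_nonpos_above_imp_bounded:
  fixes E E' :: "real \<Rightarrow> real"
  assumes der: "\<And>t. t \<ge> T \<Longrightarrow> (E has_real_derivative E' t) (at t)"
    and decr: "\<And>t. t \<ge> T \<Longrightarrow> E t \<ge> M \<Longrightarrow> E' t \<le> 0"
    and "t \<ge> T"
  shows "E t \<le> max (E T) M"
proof (rule ccontr)
  define N where "N = max (E T) M"
  assume "\<not> ?thesis"
  hence big: "E t > N" by (simp only: N_def not_le)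
  define S where "S = {u \<in> {T..t}. E u \<in> {..N}}"
  have cont: "continuous_on {T..t} E"
    by (rule DERIV_continuous_on) (auto intro: der has_field_derivative_at_within)
  have "closed S" unfolding S_def
    using cont continuous_closed_preimage[of "{T..t}" E "{..N}"] by (simp add: vimage_def Int_def)
  moreover have "S \<subseteq> {T..t}" by (auto simp: S_def)
  ultimately have "compact S"
    using compact_Int_closed[of "{T..t}" S] by (simp add: Int_absorb1)
  moreover have "T \<in> S" using \<open>t \<ge> T\<close> by (auto simp: S_def N_def)
  ultimately obtain r where r: "r \<in> S" "\<And>u. u \<in> S \<Longrightarrow> u \<le> r"
    using compact_attains_sup[of S] by blast
  hence r': "T \<le> r" "r \<le> t" "E r \<le> N" by (auto simp: S_def)
  have "E r = N"
  proof (rule ccontr)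
    assume "E r \<noteq> N"
    moreover have "continuous_on {r..t} E"
      using r' by (intro continuous_on_subset[OF cont]) auto
    ultimately obtain u where u: "r \<le> u" "u \<le> t" "E u = N"
      using IVT'[of E r N t] big r' by auto
    hence "u \<in> S" using r' by (auto simp: S_def)
    hence "u = r" using r u by force
    thus False using u \<open>E r \<noteq> N\<close> by simp
  qed
  have "E u \<ge> M" if "r \<le> u" "u \<le> t" for u
  proof (cases "u = r")
    case False
    hence "u \<notin> S" using r(2)[of u] that by auto
    thus ?thesis using r' that by (auto simp: S_def N_def)
  qed (use \<open>E r = N\<close> in \<open>simp add: N_def\<close>)
  hence "\<exists>y. (E has_real_derivative y) (at u) \<and> y \<le> 0" if "r \<le> u" "u \<le> t" for u
    using that r' der[of u] decr[of u] by force
  hence "E t \<le> E r" by (rule DERIV_nonpos_imp_nonincreasing[OF r'(2)])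
  thus False using big r' by simp
qed

section \<open>Adjoints in Hilbert spaces\<close>

lemma riesz_representation:
  fixes \<phi> :: "'a::{real_inner, complete_space} \<Rightarrow> real"
  assumes "bounded_linear \<phi>"
  obtains z where "\<And>h. \<phi> h = h \<bullet> z"
proof -
  interpret bounded_linear \<phi> by fact
  obtain K where K: "\<And>h. \<bar>\<phi> h\<bar> \<le> norm h * K"
    using bounded by (metis real_norm_def)
  \<comment> \<open>The representer is the minimizer of \<open>J\<close>; minimizing sequences are Cauchy by the parallelogram law.\<close>
  define J where "J = (\<lambda>v. (norm v)\<^sup>2 - 2 * \<phi> v)"
  define m where "m = Inf (range J)"
  have "J v \<ge> - K\<^sup>2" for v
  proof -
    have "\<phi> v \<le> norm v * K" using K[of v] by simp
    moreover have "(norm v - K)\<^sup>2 \<ge> 0" by simp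
    ultimately show ?thesis by (simp add: J_def power2_eq_square algebra_simps)
  qed
  hence bdd: "bdd_below (range J)" by (auto simp: bdd_below_def)
  have m: "m \<le> J v" for v unfolding m_def by (rule cInf_lower) (auto intro: bdd)
  define \<delta> where "\<delta> = (\<lambda>n. inverse (real (Suc n)))"
  have "\<exists>v. J v < m + \<delta> n" for n
  proof -
    have "m < m + \<delta> n" by (simp add: \<delta>_def)
    thus ?thesis using cInf_lessD[of "range J" "m + \<delta> n"] unfolding m_def by auto
  qed
  then obtain w where w: "\<And>n. J (w n) < m + \<delta> n" by metis
  have par: "(norm (u - v))\<^sup>2 \<le> 2 * (J u - m) + 2 * (J v - m)" for u v
  proof -
    have "(norm (u - v))\<^sup>2 = 2 * J u + 2 * J v - 4 * J ((1/2) *\<^sub>R (u + v))"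
      unfolding J_def power2_norm_eq_inner scaleR add
      by (simp add: inner_simps inner_commute algebra_simps)
    with m[of "(1/2) *\<^sub>R (u + v)"] show ?thesis by simp
  qed
  have "Cauchy w"
  proof (rule metric_CauchyI)
    fix e :: real assume "e > 0"
    \<comment> \<open>By \<open>par\<close>, two members of the sequence with indices at least
      \<open>N\<close> have squared distance at most \<open>4 * \<delta> N\<close>, which this
      choice pushes below the square of \<open>e\<close>.\<close>
    obtain N :: nat where N: "4 / e\<^sup>2 < real N" using reals_Archimedean2 by blast
    have "dist (w i) (w j) < e" if "i \<ge> N" "j \<ge> N" for i j
    proof -
      have "\<delta> i \<le> \<delta> N" "\<delta> j \<le> \<delta> N" using that by (auto simp: \<delta>_def)
      hence "(norm (w i - w j))\<^sup>2 \<le> 4 * \<delta> N"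
        using par[of "w i" "w j"] w[of i] w[of j] by argo
      moreover have "4 * \<delta> N < e\<^sup>2"
        using N \<open>e > 0\<close> by (simp add: \<delta>_def field_simps) (smt (verit) zero_less_power)
      ultimately have "(norm (w i - w j))\<^sup>2 < e\<^sup>2" by simp
      thus ?thesis using \<open>e > 0\<close> by (simp add: dist_norm power2_less_imp_less)
    qed
    thus "\<exists>M. \<forall>i\<ge>M. \<forall>j\<ge>M. dist (w i) (w j) < e" by blast
  qed
  then obtain z where z: "w \<longlonglongrightarrow> z" using Cauchy_convergent convergent_def by blast
  have "(\<lambda>n. J (w n)) \<longlonglongrightarrow> J z"
    unfolding J_def by (intro tendsto_intros z tendsto)
  moreover have "(\<lambda>n. m + \<delta> n) \<longlonglongrightarrow> m + 0"
    unfolding \<delta>_def by (intro tendsto_add tendsto_const LIMSEQ_inverse_real_of_nat)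
  ultimately have "J z \<le> m + 0"
    by (rule LIMSEQ_le) (use w in \<open>auto intro!: exI less_imp_le\<close>)
  hence min: "J z \<le> J v" for v using m[of v] by simp
  have "\<phi> h = h \<bullet> z" for h
  proof (rule ccontr)
    assume ne: "\<phi> h \<noteq> h \<bullet> z"
    define d where "d = \<phi> h - h \<bullet> z"
    \<comment> \<open>Along the line through \<open>z\<close> in direction \<open>h\<close>,
      \<open>J\<close> changes by a quadratic in the step length that is least at \<open>d\<close>
      over the squared norm of \<open>h\<close>. Adding 1 to the denominator avoids the case
      \<open>h = 0\<close> and still makes \<open>J\<close> decrease strictly.\<close>
    define Q where "Q = (norm h)\<^sup>2 + 1"
    have "Q > 0" "(norm h)\<^sup>2 < Q" by (auto simp: Q_def add_nonneg_pos)
    have "J (z + a *\<^sub>R h) - J z = a\<^sup>2 * (norm h)\<^sup>2 - 2 * a * d" for a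
      unfolding J_def power2_norm_eq_inner scaleR add d_def
      by (simp add: inner_simps inner_commute algebra_simps power2_eq_square)
    hence "J (z + (d / Q) *\<^sub>R h) - J z = (d / Q)\<^sup>2 * (norm h)\<^sup>2 - 2 * (d / Q) * d" .
    also have "\<dots> < (d / Q)\<^sup>2 * Q - 2 * (d / Q) * d"
      using ne \<open>(norm h)\<^sup>2 < Q\<close> \<open>Q > 0\<close> by (simp add: d_def)
    also have "\<dots> = - (d\<^sup>2 / Q)"
      using \<open>Q > 0\<close> by (simp add: power2_eq_square field_simps)
    also have "\<dots> \<le> 0" using \<open>Q > 0\<close> by simp
    finally show False using min[of "z + (d / Q) *\<^sub>R h"] by simp
  qed
  thus ?thesis using that by blast
qed

text \<open>\<open>adjoint\<close> is a Hilbert choice, so its defining identity holds as soon as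
  some adjoint map exists. Riesz representation of the functionals that send \<open>h\<close> to
  \<open>A h \<bullet> y\<close> supplies one.\<close>

lemma adjoint_bounded_linear_works:
  fixes A :: "'a::{real_inner, complete_space} \<Rightarrow> 'b::real_inner"
  assumes "bounded_linear A"
  shows "A u \<bullet> v = u \<bullet> adjoint A v"
proof -
  have "\<exists>z. \<forall>h. A h \<bullet> y = h \<bullet> z" for y
    using riesz_representation[OF bounded_linear_inner_left_comp[OF assms, of y]] by metis
  hence "\<exists>g. \<forall>x y. A x \<bullet> y = x \<bullet> g y" by metis
  from someI_ex[OF this] show ?thesis unfolding adjoint_def by blast
qed

section \<open>Convexity and saddle points\<close>

text \<open>Restriction to the line through \<open>u\<close> and \<open>v\<close> reduces this to
  the tangent inequality for a convex function of one real variable, between 0 and 1.\<close>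

lemma convex_gderiv_tangent:
  fixes f :: "'a::real_inner \<Rightarrow> real"
  assumes "convex_on UNIV f" "GDERIV f u :> g"
  shows "f v - f u \<ge> (v - u) \<bullet> g"
proof -
  define h where "h = (\<lambda>r. f (u + r *\<^sub>R (v - u)))"
  have "convex_on UNIV h"
  proof (rule convex_onI)
    fix r a b :: real assume r: "0 < r" "r < 1"
    have *: "u + ((1 - r) *\<^sub>R a + r *\<^sub>R b) *\<^sub>R (v - u)
      = (1 - r) *\<^sub>R (u + a *\<^sub>R (v - u)) + r *\<^sub>R (u + b *\<^sub>R (v - u))"
      by (simp add: algebra_simps)
    show "h ((1 - r) *\<^sub>R a + r *\<^sub>R b) \<le> (1 - r) * h a + r * h b"
      unfolding h_def * using r by (intro convex_onD[OF assms(1)]) auto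
  qed simp
  moreover have "(h has_real_derivative (v - u) \<bullet> g) (at 0)"
  proof -
    have "((\<lambda>r. u + r *\<^sub>R (v - u)) has_derivative (\<lambda>r. r *\<^sub>R (v - u))) (at 0)"
      by (auto intro!: derivative_eq_intros)
    moreover have "(f has_derivative (\<lambda>h. h \<bullet> g)) (at (u + 0 *\<^sub>R (v - u)))"
      using assms(2) by (simp add: gderiv_def)
    ultimately have "(h has_derivative (\<lambda>r. (r *\<^sub>R (v - u)) \<bullet> g)) (at 0)"
      unfolding h_def by (rule has_derivative_compose)
    thus ?thesis by (simp add: has_field_derivative_def mult.commute[of _ "(v - u) \<bullet> g"])
  qed
  ultimately have "h 1 - h 0 \<ge> ((v - u) \<bullet> g) * (1 - 0)"
    by (intro convex_on_imp_above_tangent[where A = UNIV]) auto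
  thus ?thesis by (simp add: h_def)
qed

text \<open>Moving the multiplier by the residual \<open>A u - b\<close> raises the Lagrangian by
  the squared norm of that residual, and a saddle point allows no rise.\<close>

lemma saddle_point_feasible:
  assumes "(u, v) \<in> saddle_points f A b"
  shows "A u = b"
proof -
  have "lagrangian f A b u (v + (A u - b)) \<le> lagrangian f A b u v"
    using assms by (auto simp: saddle_points_def)
  hence "(A u - b) \<bullet> (A u - b) \<le> 0" by (simp add: lagrangian_def inner_simps)
  thus ?thesis by (metis eq_iff_diff_eq_0 inner_eq_zero_iff inner_ge_zero order_antisym)
qed

lemma saddle_point_minimal:
  assumes "(u, v) \<in> saddle_points f A b"
  shows "lagrangian f A b u v \<le> lagrangian f A b z v"
  using assms by (auto simp: saddle_points_def)

section \<open>Energy estimates\<close>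

lemma has_real_derivative_norm_square:
  assumes "(u has_vector_derivative u') (at t)"
  shows "((\<lambda>t. (norm (u t))\<^sup>2) has_real_derivative 2 * (u t \<bullet> u')) (at t)"
proof -
  have "((\<lambda>t. u t \<bullet> u t) has_vector_derivative u t \<bullet> u' + u' \<bullet> u t) (at t)"
    by (rule bounded_bilinear.has_vector_derivative[OF bounded_bilinear_inner assms assms])
  thus ?thesis
    by (simp add: power2_norm_eq_inner inner_commute has_real_derivative_iff_has_vector_derivative)
qed

lemma has_real_derivative_gderiv_compose:
  assumes "GDERIV f (u t) :> g" "(u has_vector_derivative u') (at t)"
  shows "((\<lambda>t. f (u t)) has_real_derivative u' \<bullet> g) (at t)"
proof -
  have "((\<lambda>t. f (u t)) has_derivative (\<lambda>h. (h *\<^sub>R u') \<bullet> g)) (at t)"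
    using has_derivative_compose[of u "\<lambda>h. h *\<^sub>R u'" t UNIV f "\<lambda>h. h \<bullet> g"] assms
    unfolding has_vector_derivative_def gderiv_def by blast
  thus ?thesis by (simp add: has_field_derivative_def mult_commute_abs)
qed

text \<open>The cancellation of cross terms in the energy derivative. Here \<open>y\<close>,
  \<open>xx\<close> and \<open>m\<close> stand for \<open>x - xs\<close>, \<open>x\<close> and
  \<open>l - ls\<close>; \<open>a\<close> and \<open>as\<close> are the adjoint images of
  \<open>l\<close> and \<open>ls\<close>; \<open>r\<close>, \<open>S\<close> and \<open>e\<close>
  are \<open>t powr q\<close>, \<open>t powr s\<close> and \<open>c / t powr p\<close>. Terms that
  come from differentiating the time-dependent weights of the energy are left out.\<close>

lemma dissipation_identity:
  fixes x' g a as y xx :: "'a::real_inner" and m l Ay Ax' :: "'b::real_inner"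
  assumes "y \<bullet> (a - as) = Ay \<bullet> m" "x' \<bullet> (a - as) = Ax' \<bullet> m"
  shows "(y + (\<theta> * r) *\<^sub>R x') \<bullet> (- k *\<^sub>R x' - (\<theta> * (r * S)) *\<^sub>R (g + a + e *\<^sub>R xx))
      + k * (y \<bullet> x') + \<theta> * (m \<bullet> ((r * S) *\<^sub>R (Ay + (\<theta> * r) *\<^sub>R Ax' - e *\<^sub>R l)))
      + \<theta>\<^sup>2 * (r\<^sup>2 * S) * (x' \<bullet> (g + as)) + \<theta>\<^sup>2 * (r\<^sup>2 * S) * e * (xx \<bullet> x')
    = - k * \<theta> * r * (norm x')\<^sup>2 - \<theta> * (r * S) * (y \<bullet> (g + as) + e * (y \<bullet> xx) + e * (m \<bullet> l))"
proof -
  have *: "y \<bullet> a = y \<bullet> as + Ay \<bullet> m" "x' \<bullet> a = x' \<bullet> as + Ax' \<bullet> m"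
    using assms by (simp_all add: inner_simps)
  show ?thesis unfolding power2_norm_eq_inner
    by (simp add: inner_simps inner_commute[of xx] inner_commute[of m] * inner_commute[of x' y] algebra_simps power2_eq_square)
qed

text \<open>The purely scalar part of the decay estimate. \<open>X'\<close>, \<open>Y\<close>,
  \<open>M\<close>, \<open>X\<close>, \<open>L\<close> are the squared norms of \<open>x'\<close>,
  \<open>x - xs\<close>, \<open>l - ls\<close>, \<open>x\<close>, \<open>l\<close>; \<open>G\<close>
  is the Lagrangian gap, and \<open>kd\<close> and \<open>sg\<close> come from the derivatives of
  the weights. Every term of \<open>E\<close>, multiplied by \<open>r * S * P\<close>, is controlled
  by a damping term of \<open>D\<close>; the conditions on \<open>K\<close> make each of these
  comparisons work.\<close>

lemma energy_rate_bound:
  fixes \<theta> \<kappa> c r S P k kd sg X' Y M X L N G E D gy K :: real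
  assumes pos: "\<theta> > 0" "\<kappa> > 0" "c > 0" "r > 0" "S > 0" "P > 0" "K > 0"
    and nonneg: "X' \<ge> 0" "Y \<ge> 0" "M \<ge> 0" "X \<ge> 0" "L \<ge> 0" "G \<ge> 0"
    and small: "r\<^sup>2 * S * P \<le> 1"
    and k: "\<kappa> \<le> k" "k \<le> 2 * \<kappa>"
    and kd: "2 * kd \<le> \<theta> * c * (r * S * P)"
    and sg: "2 * sg \<le> \<theta> * (r * S)"
    and gy: "G \<le> gy"
    and K: "K * (1 + \<kappa>) \<le> \<theta> * c / 4" "K * \<theta> \<le> \<kappa>" "K \<le> c" "2 * \<theta> * K \<le> 1"
    and D: "D \<le> - k * \<theta> * r * X' + kd / 2 * Y
        - \<theta> * (r * S) * (gy + c * P * ((Y + X + M + L - N) / 2)) + sg * G"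
    and E: "E \<le> Y + \<theta>\<^sup>2 * r\<^sup>2 * X' + k / 2 * Y + \<theta> / 2 * M + \<theta>\<^sup>2 * (r\<^sup>2 * S * G)
        + \<theta>\<^sup>2 * c / 2 * (r\<^sup>2 * S * P * X)"
  shows "D \<le> (r * S * P) * (\<theta> * c * N / 2 - K * E)"
proof -
  define \<rho> where "\<rho> = r * S * P"
  have \<rho>: "\<rho> > 0" using pos by (simp add: \<rho>_def)
  have r\<rho>: "r * \<rho> \<le> 1" using small by (simp add: \<rho>_def power2_eq_square mult.assoc)
  \<comment> \<open>Half of the damping in \<open>Y\<close> absorbs the \<open>kd\<close> term, and
    half of the damping in \<open>G\<close> absorbs the \<open>sg\<close> term.\<close>
  have D2: "D \<le> - \<kappa> * \<theta> * r * X' - \<theta> * (r * S) / 2 * G - \<theta> * \<rho> * c / 4 * Y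
      - \<theta> * \<rho> * c / 2 * (M + X) + \<theta> * \<rho> * c / 2 * N"
  proof -
    have "\<kappa> * (\<theta> * r * X') \<le> k * (\<theta> * r * X')"
      using k pos nonneg by (intro mult_right_mono) auto
    moreover have "2 * kd * Y \<le> \<theta> * c * \<rho> * Y"
      using kd nonneg unfolding \<rho>_def by (intro mult_right_mono) auto
    moreover have "\<theta> * (r * S) * G \<le> \<theta> * (r * S) * gy"
      using gy pos by (intro mult_left_mono) auto
    moreover have "2 * sg * G \<le> \<theta> * (r * S) * G"
      using sg nonneg by (intro mult_right_mono) auto
    moreover have "\<theta> * c * \<rho> * L \<ge> 0" using pos \<rho> nonneg by simp
    ultimately show ?thesis using D unfolding \<rho>_def by (simp add: field_simps)
  qed
  \<comment> \<open>The surplus powers of \<open>r\<close> in the energy are removed by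
    \<open>r * \<rho> \<le> 1\<close>.\<close>
  have E2: "\<rho> * E \<le> \<rho> * (1 + \<kappa>) * Y + \<theta>\<^sup>2 * r * X' + \<theta> / 2 * \<rho> * M + \<theta>\<^sup>2 * (r * S) * G
      + \<theta>\<^sup>2 * c / 2 * \<rho> * X"
  proof -
    have "r * (\<theta>\<^sup>2 * X') * (r * \<rho>) \<le> r * (\<theta>\<^sup>2 * X') * 1"
      "\<theta>\<^sup>2 * (r * S) * G * (r * \<rho>) \<le> \<theta>\<^sup>2 * (r * S) * G * 1"
      "\<theta>\<^sup>2 * c * \<rho> * X * (r * \<rho>) \<le> \<theta>\<^sup>2 * c * \<rho> * X * 1"
      using pos nonneg \<rho> r\<rho> by (intro mult_left_mono; simp)+
    moreover have "\<rho> * (k * Y) \<le> \<rho> * (2 * \<kappa> * Y)"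
      using k \<rho> nonneg by (intro mult_left_mono mult_right_mono) auto
    moreover have "\<rho> * E \<le> \<rho> * (Y + \<theta>\<^sup>2 * r\<^sup>2 * X' + k / 2 * Y + \<theta> / 2 * M + \<theta>\<^sup>2 * (r\<^sup>2 * S * G)
        + \<theta>\<^sup>2 * c / 2 * (r * \<rho> * X))"
      using E \<rho> by (intro mult_left_mono) (auto simp: \<rho>_def power2_eq_square mult_ac)
    ultimately show ?thesis by (simp add: field_simps power2_eq_square)
  qed
  have "K * (\<rho> * E) \<le> K * (\<rho> * (1 + \<kappa>) * Y + \<theta>\<^sup>2 * r * X' + \<theta> / 2 * \<rho> * M + \<theta>\<^sup>2 * (r * S) * G
      + \<theta>\<^sup>2 * c / 2 * \<rho> * X)"
    using E2 pos by (intro mult_left_mono) auto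
  moreover have "(K * (1 + \<kappa>)) * (\<rho> * Y) \<le> (\<theta> * c / 4) * (\<rho> * Y)"
    "(K * \<theta>) * (\<theta> * r * X') \<le> \<kappa> * (\<theta> * r * X')"
    "K * (\<theta> * \<rho> * M) \<le> c * (\<theta> * \<rho> * M)"
    "(2 * \<theta> * K) * (\<theta> * (r * S) * G) \<le> 1 * (\<theta> * (r * S) * G)"
    "(2 * \<theta> * K) * (\<theta> * c * \<rho> * X) \<le> 1 * (\<theta> * c * \<rho> * X)"
    using K pos nonneg \<rho> by (intro mult_right_mono; simp)+
  moreover have "\<theta> * c * \<rho> * X \<ge> 0" using pos \<rho> nonneg by simp
  ultimately have "D \<le> \<theta> * \<rho> * c / 2 * N - K * (\<rho> * E)"
    using D2 by (simp add: field_simps power2_eq_square)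
  thus ?thesis by (simp add: \<rho>_def field_simps)
qed

text \<open>The energy is bounded by the barrier principle, and all its summands are nonnegative, so
  each is bounded separately. The system appears solved for its highest derivatives, and
  \<open>B\<close> enters only through its pairing with \<open>A\<close>. The bounds in
  \<open>small\<close> are those that hold for all large times.\<close>

lemma trajectory_bounded:
  fixes xs :: "'a::real_inner" and ls :: "'b::real_inner"
    and x x' :: "real \<Rightarrow> 'a" and l :: "real \<Rightarrow> 'b"
    and gf :: "'a \<Rightarrow> 'a" and A :: "'a \<Rightarrow> 'b" and B :: "'b \<Rightarrow> 'a" and \<phi> :: "'a \<Rightarrow> real"
  assumes A: "linear A" and AB: "\<And>u v. A u \<bullet> v = u \<bullet> B v"
    and gd: "\<And>z. GDERIV \<phi> z :> gf z + B ls"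
    and nonneg: "\<And>z. \<phi> z \<ge> 0"
    and tangent: "\<And>z. (z - xs) \<bullet> (gf z + B ls) \<ge> \<phi> z"
    and pos: "\<theta> > 0" "c > 0" "\<kappa> > 0" and \<kappa>: "\<theta> * \<alpha> = 1 + 2 * \<kappa>"
    and pq: "0 \<le> q" "q < 1" "s \<le> p - 2 * q"
    and T: "T \<ge> 1"
    and small: "\<And>t. t \<ge> T \<Longrightarrow> 2 * \<theta> * (2 * q + s) * t powr (q - 1) \<le> 1"
      "\<And>t. t \<ge> T \<Longrightarrow> \<theta> * q * t powr (q - 1) \<le> \<kappa>"
      "\<And>t. t \<ge> T \<Longrightarrow> 2 * q * (1 - q) * t powr (p - s - 2) \<le> c"
    and dx: "\<And>t. t \<ge> T \<Longrightarrow> (x has_vector_derivative x' t) (at t)"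
    and dx': "\<And>t. t \<ge> T \<Longrightarrow> (x' has_vector_derivative
        - (\<alpha> / t powr q) *\<^sub>R x' t - (t powr s) *\<^sub>R (gf (x t) + B (l t) + (c / t powr p) *\<^sub>R x t)) (at t)"
    and dl: "\<And>t. t \<ge> T \<Longrightarrow> (l has_vector_derivative
        (t powr (q + s)) *\<^sub>R (A (x t + (\<theta> * t powr q) *\<^sub>R x' t) - A xs - (c / t powr p) *\<^sub>R l t)) (at t)"
  shows "\<exists>K. \<forall>t\<ge>T. t powr (2 * q + s) * \<phi> (x t) \<le> K \<and> norm (l t) \<le> K"
proof -
  define g where "g = (\<lambda>t. gf (x t))"
  define e where "e = (\<lambda>t. c / t powr p)"
  \<comment> \<open>This is the weight from the overview, rewritten with
    \<open>\<theta> * \<alpha> = 1 + 2 * \<kappa>\<close>. Differentiating \<open>v\<close> produces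
    exactly \<open>- k t\<close> times \<open>x' t\<close>, which is why the same weight belongs in
    \<open>E\<close>.\<close>
  define k where "k = (\<lambda>t::real. 2 * \<kappa> - \<theta> * q * t powr (q - 1))"
  define v where "v = (\<lambda>t. (x t - xs) + (\<theta> * t powr q) *\<^sub>R x' t)"
  define v' where "v' = (\<lambda>t. - k t *\<^sub>R x' t - (\<theta> * (t powr q * t powr s)) *\<^sub>R (g t + B (l t) + e t *\<^sub>R x t))"
  define l' where "l' = (\<lambda>t. (t powr q * t powr s) *\<^sub>R
    (A (x t - xs) + (\<theta> * t powr q) *\<^sub>R A (x' t) - e t *\<^sub>R l t))"
  define E where "E = (\<lambda>t. (norm (v t))\<^sup>2 / 2 + k t / 2 * (norm (x t - xs))\<^sup>2 + \<theta> / 2 * (norm (l t - ls))\<^sup>2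
    + \<theta>\<^sup>2 * (t powr (2 * q + s) * \<phi> (x t)) + \<theta>\<^sup>2 * c / 2 * (t powr (2 * q + s - p) * (norm (x t))\<^sup>2))"
  define kd where "kd = (\<lambda>t::real. \<theta> * q * (1 - q) * t powr (q - 2))"
  define D where "D = (\<lambda>t. v t \<bullet> v' t + (kd t / 2 * (norm (x t - xs))\<^sup>2 + k t * ((x t - xs) \<bullet> x' t))
    + \<theta> * ((l t - ls) \<bullet> l' t)
    + \<theta>\<^sup>2 * ((2 * q + s) * t powr (2 * q + s - 1) * \<phi> (x t) + t powr (2 * q + s) * (x' t \<bullet> (g t + B ls)))
    + \<theta>\<^sup>2 * c / 2 * ((2 * q + s - p) * t powr (2 * q + s - p - 1) * (norm (x t))\<^sup>2
        + t powr (2 * q + s - p) * (2 * (x t \<bullet> x' t))))"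
  define N where "N = (norm xs)\<^sup>2 + (norm ls)\<^sup>2"
  define K where "K = Min {\<theta> * c / 4 / (1 + \<kappa>), \<kappa> / \<theta>, c, 1 / (2 * \<theta>)}"
  \<comment> \<open>Additivity of \<open>B\<close> follows from the pairing identity by testing
    against every vector \<open>z\<close>.\<close>
  have Bdiff: "B (u - w) = B u - B w" for u w
  proof -
    have "z \<bullet> (B (u - w) - (B u - B w)) = 0" for z
      unfolding inner_diff_right AB[symmetric] by simp
    thus ?thesis by (metis inner_eq_zero_iff eq_iff_diff_eq_0)
  qed
  have Kpos: "K > 0" using pos by (simp add: K_def)
  have "K \<le> \<theta> * c / 4 / (1 + \<kappa>)" "K \<le> \<kappa> / \<theta>" "K \<le> c" "K \<le> 1 / (2 * \<theta>)"
    by (simp_all add: K_def)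
  hence K: "K * (1 + \<kappa>) \<le> \<theta> * c / 4" "K * \<theta> \<le> \<kappa>" "K \<le> c" "2 * \<theta> * K \<le> 1"
    using pos by (simp_all add: pos_le_divide_eq mult_ac)
  have dE: "(E has_real_derivative D t) (at t)" if t: "t \<ge> T" for t
  proof -
    have t0: "t > 0" using t T by simp
    have dk: "(k has_real_derivative kd t) (at t)"
      unfolding k_def kd_def
      using DERIV_diff[OF DERIV_const[of "2 * \<kappa>"]
          DERIV_cmult[OF has_real_derivative_powr[OF t0, of "q - 1"], of "\<theta> * q"]]
      by (simp add: algebra_simps)
    have dv: "(v has_vector_derivative v' t) (at t)"
      unfolding v_def
    proof (rule has_vector_derivative_eq_rhs)
      have *: "(X - 0) + ((\<theta> * r) *\<^sub>R (- (\<alpha> / r) *\<^sub>R X - S *\<^sub>R W) + (\<theta> * (q * z)) *\<^sub>R X)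
          = - (2 * \<kappa> - \<theta> * q * z) *\<^sub>R X - (\<theta> * (r * S)) *\<^sub>R W" if "r \<noteq> 0" for X W :: 'a and r S z
        using that \<kappa> by (simp add: scaleR_right_diff_distrib mult.assoc) (simp add: algebra_simps)
      show "((\<lambda>t. (x t - xs) + (\<theta> * t powr q) *\<^sub>R x' t) has_vector_derivative
          (x' t - 0) + ((\<theta> * t powr q) *\<^sub>R (- (\<alpha> / t powr q) *\<^sub>R x' t
            - (t powr s) *\<^sub>R (gf (x t) + B (l t) + (c / t powr p) *\<^sub>R x t))
          + (\<theta> * (q * t powr (q - 1))) *\<^sub>R x' t)) (at t)"
        by (rule has_vector_derivative_add has_vector_derivative_diff has_vector_derivative_const
          has_vector_derivative_scaleR dx[OF t] dx'[OF t] DERIV_cmult has_real_derivative_powr[OF t0])+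
      show "(x' t - 0) + ((\<theta> * t powr q) *\<^sub>R (- (\<alpha> / t powr q) *\<^sub>R x' t
            - (t powr s) *\<^sub>R (gf (x t) + B (l t) + (c / t powr p) *\<^sub>R x t))
          + (\<theta> * (q * t powr (q - 1))) *\<^sub>R x' t) = v' t"
        unfolding v'_def k_def g_def e_def by (rule *) (use t0 in simp)
    qed
    have "A (x t + (\<theta> * t powr q) *\<^sub>R x' t) - A xs = A (x t - xs) + (\<theta> * t powr q) *\<^sub>R A (x' t)"
      by (simp add: linear_add[OF A] linear_diff[OF A] linear_scale[OF A])
    hence dl2: "((\<lambda>t. l t - ls) has_vector_derivative l' t) (at t)"
      using has_vector_derivative_diff[OF dl[OF t] has_vector_derivative_const[of ls]]
      by (simp only: l'_def e_def powr_add diff_0_right)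
    have dx2: "((\<lambda>t. x t - xs) has_vector_derivative x' t) (at t)"
      using has_vector_derivative_diff[OF dx[OF t] has_vector_derivative_const[of xs]] by simp
    note [derivative_intros] = has_real_derivative_norm_square[OF dv] has_real_derivative_norm_square[OF dl2]
      has_real_derivative_norm_square[OF dx2] has_real_derivative_norm_square[OF dx[OF t]] dk
      has_real_derivative_gderiv_compose[OF gd dx[OF t]]
    show ?thesis unfolding E_def
      using t0 by (auto intro!: derivative_eq_intros simp: D_def g_def) (simp add: field_simps)
  qed
  have decay: "D t \<le> (t powr q * t powr s * t powr (-p)) * (\<theta> * c * N / 2 - K * E t)"
    and nn: "k t \<ge> 0" if t: "t \<ge> T" for t
  proof -
    have t1: "t \<ge> 1" using t T by simp
    define r S P where "r = t powr q" and "S = t powr s" and "P = t powr (-p)"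
    have rsp: "r > 0" "S > 0" "P > 0" using t1 by (simp_all add: r_def S_def P_def)
    have r2: "t powr (2 * q) = r\<^sup>2" unfolding r_def mult_2 powr_add power2_eq_square ..
    have pw1: "t powr (2 * q + s) = r\<^sup>2 * S"
      by (simp only: powr_add r2 S_def)
    have pw2: "t powr (2 * q + s - 1) = r\<^sup>2 * S / t" "t powr (q - 1) = r / t"
      using t1 by (simp_all only: powr_diff pw1 r_def) simp_all
    have pw3: "t powr (2 * q + s - p) = r\<^sup>2 * S * P"
      unfolding powr_diff pw1 P_def powr_minus_divide by simp
    note pw = pw1 pw2(1) pw3 pw2(2)
    have e: "e t = c * P" using t1 by (simp add: e_def P_def powr_minus field_simps)
    show "k t \<ge> 0" using small(2)[OF t] pos by (simp add: k_def)
    show "D t \<le> (t powr q * t powr s * t powr (-p)) * (\<theta> * c * N / 2 - K * E t)"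
      unfolding r_def[symmetric] S_def[symmetric] P_def[symmetric]
    proof (rule energy_rate_bound[OF pos(1,3,2) rsp Kpos])
      show "r\<^sup>2 * S * P \<le> 1" unfolding pw(3)[symmetric]
        using t1 pq powr_mono[of "2 * q + s - p" 0 t] by simp
      show "\<kappa> \<le> k t" using small(2)[OF t] by (simp add: k_def)
      show "k t \<le> 2 * \<kappa>" using pos pq by (simp add: k_def)
      \<comment> \<open>The growth of \<open>k\<close> is compared with the decay rate
        \<open>r * S * P\<close>, that is \<open>t powr (q + s - p)\<close>; the quotient is
        \<open>t powr (p - s - 2)\<close>, which \<open>small(3)\<close> controls.\<close>
      have "t powr (q - 2) = r * S * P * t powr (p - s - 2)"
        using t1 by (simp add: r_def S_def P_def powr_add[symmetric])
      hence "2 * kd t = \<theta> * (r * S * P) * (2 * q * (1 - q) * t powr (p - s - 2))"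
        by (simp add: kd_def)
      also have "\<dots> \<le> \<theta> * (r * S * P) * c"
        using small(3)[OF t] pos rsp by (intro mult_left_mono) auto
      finally show "2 * kd t \<le> \<theta> * c * (r * S * P)" by (simp add: mult_ac)
      have "(2 * \<theta> * (2 * q + s) * (r / t)) * (\<theta> * (r * S)) \<le> 1 * (\<theta> * (r * S))"
        using small(1)[OF t] pos rsp unfolding pw by (intro mult_right_mono) auto
      thus "2 * (\<theta>\<^sup>2 * (2 * q + s) * (r\<^sup>2 * S / t)) \<le> \<theta> * (r * S)"
        by (simp add: power2_eq_square mult_ac)
      show "\<phi> (x t) \<le> (x t - xs) \<bullet> (g t + B ls)" using tangent[of "x t"] by (simp add: g_def)
      have "D t = v t \<bullet> v' t + k t * ((x t - xs) \<bullet> x' t) + \<theta> * ((l t - ls) \<bullet> l' t)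
         + \<theta>\<^sup>2 * (r\<^sup>2 * S) * (x' t \<bullet> (g t + B ls)) + \<theta>\<^sup>2 * (r\<^sup>2 * S) * e t * (x t \<bullet> x' t)
         + kd t / 2 * (norm (x t - xs))\<^sup>2 + \<theta>\<^sup>2 * (2 * q + s) * (r\<^sup>2 * S / t) * \<phi> (x t)
         + \<theta>\<^sup>2 * c / 2 * ((2 * q + s - p) * t powr (2 * q + s - p - 1) * (norm (x t))\<^sup>2)"
        unfolding D_def pw e by (simp add: algebra_simps add_divide_distrib)
      also have "v t \<bullet> v' t + k t * ((x t - xs) \<bullet> x' t) + \<theta> * ((l t - ls) \<bullet> l' t)
         + \<theta>\<^sup>2 * (r\<^sup>2 * S) * (x' t \<bullet> (g t + B ls)) + \<theta>\<^sup>2 * (r\<^sup>2 * S) * e t * (x t \<bullet> x' t)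
         = - k t * \<theta> * r * (norm (x' t))\<^sup>2 - \<theta> * (r * S) *
           ((x t - xs) \<bullet> (g t + B ls) + e t * ((x t - xs) \<bullet> x t) + e t * ((l t - ls) \<bullet> l t))"
        unfolding v_def v'_def l'_def r_def[symmetric] S_def[symmetric]
        by (rule dissipation_identity) (simp_all add: AB Bdiff)
      \<comment> \<open>Polarization turns the regularization terms into damping by squared norms,
        at the price of the constant \<open>N\<close>.\<close>
      also have "(x t - xs) \<bullet> x t = ((norm (x t - xs))\<^sup>2 + (norm (x t))\<^sup>2 - (norm xs)\<^sup>2) / 2"
        unfolding power2_norm_eq_inner by (simp add: inner_simps inner_commute)
      also have "(l t - ls) \<bullet> l t = ((norm (l t - ls))\<^sup>2 + (norm (l t))\<^sup>2 - (norm ls)\<^sup>2) / 2"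
        unfolding power2_norm_eq_inner by (simp add: inner_simps inner_commute)
      finally have "D t = - k t * \<theta> * r * (norm (x' t))\<^sup>2 + kd t / 2 * (norm (x t - xs))\<^sup>2
         - \<theta> * (r * S) * ((x t - xs) \<bullet> (g t + B ls) + c * P * (((norm (x t - xs))\<^sup>2 + (norm (x t))\<^sup>2
            + (norm (l t - ls))\<^sup>2 + (norm (l t))\<^sup>2 - N) / 2))
         + \<theta>\<^sup>2 * (2 * q + s) * (r\<^sup>2 * S / t) * \<phi> (x t)
         + \<theta>\<^sup>2 * c / 2 * ((2 * q + s - p) * t powr (2 * q + s - p - 1) * (norm (x t))\<^sup>2)"
        by (simp add: e N_def field_simps)
      moreover have "\<theta>\<^sup>2 * c / 2 * ((2 * q + s - p) * t powr (2 * q + s - p - 1) * (norm (x t))\<^sup>2) \<le> 0"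
        using pos pq by (intro mult_nonneg_nonpos mult_nonpos_nonneg) auto
      ultimately show "D t \<le> - k t * \<theta> * r * (norm (x' t))\<^sup>2 + kd t / 2 * (norm (x t - xs))\<^sup>2
         - \<theta> * (r * S) * ((x t - xs) \<bullet> (g t + B ls) + c * P * (((norm (x t - xs))\<^sup>2 + (norm (x t))\<^sup>2
            + (norm (l t - ls))\<^sup>2 + (norm (l t))\<^sup>2 - N) / 2))
         + \<theta>\<^sup>2 * (2 * q + s) * (r\<^sup>2 * S / t) * \<phi> (x t)" by linarith
      have "(norm (v t))\<^sup>2 \<le> 2 * (norm (x t - xs))\<^sup>2 + 2 * (\<theta>\<^sup>2 * r\<^sup>2 * (norm (x' t))\<^sup>2)"
      proof -
        have "(norm (v t))\<^sup>2 \<le> (norm (x t - xs) + norm ((\<theta> * r) *\<^sub>R x' t))\<^sup>2"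
          unfolding v_def r_def by (intro power_mono norm_triangle_ineq) auto
        also have "\<dots> \<le> 2 * (norm (x t - xs))\<^sup>2 + 2 * (norm ((\<theta> * r) *\<^sub>R x' t))\<^sup>2"
          using sum_squares_ge_zero[of "norm (x t - xs) - norm ((\<theta> * r) *\<^sub>R x' t)" 0]
          by (simp add: power2_eq_square algebra_simps)
        finally show ?thesis by (simp add: power_mult_distrib)
      qed
      thus "E t \<le> (norm (x t - xs))\<^sup>2 + \<theta>\<^sup>2 * r\<^sup>2 * (norm (x' t))\<^sup>2 + k t / 2 * (norm (x t - xs))\<^sup>2
          + \<theta> / 2 * (norm (l t - ls))\<^sup>2 + \<theta>\<^sup>2 * (r\<^sup>2 * S * \<phi> (x t))
          + \<theta>\<^sup>2 * c / 2 * (r\<^sup>2 * S * P * (norm (x t))\<^sup>2)"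
        unfolding E_def pw by simp
    qed (use K nonneg in simp_all)
  qed
  \<comment> \<open>The second argument is the energy level at which the bound in
    \<open>decay\<close> changes sign.\<close>
  define M where "M = max (E T) (\<theta> * c * N / (2 * K))"
  have EM: "E t \<le> M" if t: "t \<ge> T" for t
    unfolding M_def
  proof (rule deriv_nonpos_above_imp_bounded[OF dE _ t])
    fix u assume u: "u \<ge> T" "E u \<ge> \<theta> * c * N / (2 * K)"
    hence "\<theta> * c * N / 2 - K * E u \<le> 0" using Kpos by (simp add: field_simps)
    hence "(u powr q * u powr s * u powr (-p)) * (\<theta> * c * N / 2 - K * E u) \<le> 0"
      by (intro mult_nonneg_nonpos) auto
    thus "D u \<le> 0" using decay[OF u(1)] by linarith
  qed auto
  have bounds: "t powr (2 * q + s) * \<phi> (x t) \<le> M / \<theta>\<^sup>2 \<and> norm (l t) \<le> norm ls + sqrt (2 * M / \<theta>)"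
    if t: "t \<ge> T" for t
  proof
    have nns: "(norm (v t))\<^sup>2 / 2 \<ge> 0" "k t / 2 * (norm (x t - xs))\<^sup>2 \<ge> 0"
      "\<theta> / 2 * (norm (l t - ls))\<^sup>2 \<ge> 0" "\<theta>\<^sup>2 * (t powr (2 * q + s) * \<phi> (x t)) \<ge> 0"
      "\<theta>\<^sup>2 * c / 2 * (t powr (2 * q + s - p) * (norm (x t))\<^sup>2) \<ge> 0"
      using nn[OF t] pos nonneg by simp_all
    with EM[OF t] have "\<theta>\<^sup>2 * (t powr (2 * q + s) * \<phi> (x t)) \<le> M" "\<theta> / 2 * (norm (l t - ls))\<^sup>2 \<le> M"
      unfolding E_def by linarith+
    thus "t powr (2 * q + s) * \<phi> (x t) \<le> M / \<theta>\<^sup>2" using pos by (simp add: field_simps)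
    have "(norm (l t - ls))\<^sup>2 \<le> 2 * M / \<theta>"
      using \<open>\<theta> / 2 * (norm (l t - ls))\<^sup>2 \<le> M\<close> pos by (simp add: field_simps)
    hence "norm (l t - ls) \<le> sqrt (2 * M / \<theta>)" by (simp add: real_le_rsqrt)
    thus "norm (l t) \<le> norm ls + sqrt (2 * M / \<theta>)" using norm_triangle_sub[of "l t" ls] by linarith
  qed
  show ?thesis
    by (rule exI[of _ "max (M / \<theta>\<^sup>2) (norm ls + sqrt (2 * M / \<theta>))"]) (use bounds in \<open>auto simp: le_max_iff_disj\<close>)
qed

section \<open>Decay of the constraint residual\<close>

text \<open>The equation for \<open>u\<close> is linear, with damping of order
  \<open>t powr (-q)\<close>. Its forcing by the bounded multiplier has at most the same order,
  because \<open>q + s - p \<le> -q\<close>. Hence \<open>u\<close> stays bounded, and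
  \<open>u + l\<close> is the scaled residual.\<close>

lemma feasibility_bounded:
  fixes xs :: "'a::real_inner" and x x' :: "real \<Rightarrow> 'a" and l :: "real \<Rightarrow> 'b::real_inner"
  assumes A: "bounded_linear A"
    and pos: "\<theta> > 0" "c > 0" "2 * q + s \<ge> 0"
    and pq: "s \<le> p - 2 * q"
    and T: "T \<ge> 1"
    and small: "\<And>t. t \<ge> T \<Longrightarrow> 2 * \<theta> * (2 * q + s) * t powr (q - 1) \<le> 1"
    and dx: "\<And>t. t \<ge> T \<Longrightarrow> (x has_vector_derivative x' t) (at t)"
    and dl: "\<And>t. t \<ge> T \<Longrightarrow> (l has_vector_derivative
        (t powr (q + s)) *\<^sub>R (A (x t + (\<theta> * t powr q) *\<^sub>R x' t) - A xs - (c / t powr p) *\<^sub>R l t)) (at t)"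
    and K: "\<And>t. t \<ge> T \<Longrightarrow> norm (l t) \<le> K"
  shows "\<exists>C. \<forall>t\<ge>T. t powr (2 * q + s) * norm (A (x t) - A xs) \<le> C"
proof -
  interpret A: bounded_linear A by fact
  define z where "z = (\<lambda>t. A (x t) - A xs)"
  define u where "u = (\<lambda>t. (\<theta> * t powr (2 * q + s)) *\<^sub>R z t - l t)"
  define a where "a = (\<lambda>t. 1 / t powr q - \<theta> * (2 * q + s) / t)"
  define b where "b = (\<lambda>t. t powr q * t powr s * (c / t powr p))"
  define u' where "u' = (\<lambda>t. (- (a t / \<theta>)) *\<^sub>R (u t + l t) + b t *\<^sub>R l t)"
  \<comment> \<open>Beyond this norm of \<open>u\<close>, the damping, at least
    \<open>1 / (2 * r * \<theta>)\<close> times the squared norm, outweighs the forcing, at most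
    \<open>(c / r + 1 / r / \<theta>) * K\<close> times the norm, where \<open>r\<close> is
    \<open>t powr q\<close>.\<close>
  define M where "M = 2 * (1 + \<theta> * c) * K"
  have "K \<ge> 0" using K[of T] norm_ge_zero[of "l T"] by linarith
  hence M: "M \<ge> 0" using pos by (simp add: M_def)
  have pw: "t powr (2 * q + s) = t powr q * (t powr q * t powr s)"
    "t powr (2 * q + s - 1) = t powr q * (t powr q * t powr s) / t" if "t \<ge> T" for t
    using that T unfolding mult_2 powr_add powr_diff by simp_all
  have du: "(u has_vector_derivative u' t) (at t)" if t: "t \<ge> T" for t
    unfolding u_def
  proof (rule has_vector_derivative_eq_rhs)
    have t0: "t > 0" using t T by simp
    have dz: "(z has_vector_derivative A (x' t) - 0) (at t)"
      unfolding z_def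
      by (intro has_vector_derivative_diff has_vector_derivative_const A.has_vector_derivative dx t)
    show "((\<lambda>t. (\<theta> * t powr (2 * q + s)) *\<^sub>R z t - l t) has_vector_derivative
        ((\<theta> * t powr (2 * q + s)) *\<^sub>R (A (x' t) - 0)
          + (\<theta> * ((2 * q + s) * t powr (2 * q + s - 1))) *\<^sub>R z t)
        - (t powr (q + s)) *\<^sub>R (A (x t + (\<theta> * t powr q) *\<^sub>R x' t) - A xs - (c / t powr p) *\<^sub>R l t)) (at t)"
      by (rule has_vector_derivative_diff has_vector_derivative_scaleR dz dl[OF t] DERIV_cmult
          has_real_derivative_powr[OF t0])+
    \<comment> \<open>Here \<open>y\<close> is \<open>A (x' t)\<close>: the weight of
      \<open>z\<close> in \<open>u\<close> is chosen so that its two occurrences cancel.\<close>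
    have *: "((\<theta> * (r * (r * S))) *\<^sub>R (y - 0) + (\<theta> * (\<beta> * (r * (r * S) / t))) *\<^sub>R w)
        - (r * S) *\<^sub>R (w + (\<theta> * r) *\<^sub>R y - e *\<^sub>R v)
      = (- ((1 / r - \<theta> * \<beta> / t) / \<theta>)) *\<^sub>R ((\<theta> * (r * (r * S))) *\<^sub>R w) + (r * S * e) *\<^sub>R v"
      if "r \<noteq> 0" for r S \<beta> e and y w v :: 'b
    proof -
      have 1: "(1 / r - \<theta> * \<beta> / t) / \<theta> * (\<theta> * (r * (r * S))) = r * S - \<theta> * (\<beta> * (r * (r * S) / t))"
        using that pos t0 by (simp add: field_simps)
      show ?thesis unfolding scaleR_scaleR mult_minus_left 1 by (simp add: algebra_simps)
    qed
    have "A (x t + (\<theta> * t powr q) *\<^sub>R x' t) - A xs = z t + (\<theta> * t powr q) *\<^sub>R A (x' t)"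
      by (simp add: z_def A.add A.scaleR)
    moreover have "u t + l t = (\<theta> * t powr (2 * q + s)) *\<^sub>R z t" by (simp add: u_def)
    ultimately show "((\<theta> * t powr (2 * q + s)) *\<^sub>R (A (x' t) - 0)
          + (\<theta> * ((2 * q + s) * t powr (2 * q + s - 1))) *\<^sub>R z t)
        - (t powr (q + s)) *\<^sub>R (A (x t + (\<theta> * t powr q) *\<^sub>R x' t) - A xs - (c / t powr p) *\<^sub>R l t)
        = u' t"
      unfolding u'_def a_def b_def pw[OF t] powr_add[of t q s] by (simp only:) (rule *, use t0 in simp)
  qed
  have decr: "2 * (u t \<bullet> u' t) \<le> 0" if t: "t \<ge> T" and big: "(norm (u t))\<^sup>2 \<ge> M\<^sup>2" for t
  proof -
    define r where "r = t powr q"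
    have t1: "t \<ge> 1" using t T by simp
    have r: "r > 0" using t1 by (simp add: r_def)
    have un: "norm (u t) \<ge> M" by (rule power2_le_imp_le[OF big norm_ge_zero])
    have "2 * \<theta> * (2 * q + s) * (r / t) \<le> 1"
      using small[OF t] t1 by (simp add: powr_diff r_def)
    \<comment> \<open>By \<open>small\<close>, the correction in \<open>a t\<close> takes away at
      most half of \<open>1 / r\<close>; it is nonnegative because
      \<open>2 * q + s \<ge> 0\<close>.\<close>
    hence a: "1 / (2 * r) \<le> a t" "a t \<le> 1 / r"
      using r t1 pos by (simp_all add: a_def r_def[symmetric]) (simp add: field_simps)
    have "b t * r = c * t powr (2 * q + s - p)"
      using t1 unfolding b_def r_def powr_diff pw[OF t] by simp
    also have "\<dots> \<le> c * 1"
      using t1 pq pos powr_mono[of "2 * q + s - p" 0 t] by (intro mult_left_mono) auto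
    finally have b: "b t \<le> c / r" using r by (simp add: field_simps)
    have b0: "b t \<ge> 0" using pos by (simp add: b_def)
    have a0: "a t > 0" using a r by (smt (verit) divide_pos_pos)
    have "u t \<bullet> u' t = - (a t / \<theta>) * (norm (u t))\<^sup>2 + (b t - a t / \<theta>) * (u t \<bullet> l t)"
      unfolding u'_def power2_norm_eq_inner by (simp add: inner_simps algebra_simps)
    also have "(b t - a t / \<theta>) * (u t \<bullet> l t) \<le> \<bar>b t - a t / \<theta>\<bar> * \<bar>u t \<bullet> l t\<bar>"
      by (metis abs_ge_self abs_mult)
    also have "\<dots> \<le> (c / r + 1 / r / \<theta>) * (norm (u t) * K)"
    proof (rule mult_mono)
      have "a t / \<theta> \<le> 1 / r / \<theta>" "a t / \<theta> \<ge> 0"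
        using a a0 pos by (simp_all only: divide_right_mono less_imp_le divide_nonneg_pos)
      thus "\<bar>b t - a t / \<theta>\<bar> \<le> c / r + 1 / r / \<theta>" using b b0 by linarith
      show "\<bar>u t \<bullet> l t\<bar> \<le> norm (u t) * K"
        using Cauchy_Schwarz_ineq2[of "u t" "l t"] mult_left_mono[OF K[OF t], of "norm (u t)"] by simp
    qed (use r pos in simp_all)
    also have "\<dots> = (norm (u t) / (2 * r * \<theta>)) * M"
      using r pos by (simp add: M_def field_simps)
    also have "\<dots> \<le> (norm (u t) / (2 * r * \<theta>)) * norm (u t)"
      using un r pos by (intro mult_left_mono) auto
    also have "\<dots> = (1 / (2 * r)) / \<theta> * (norm (u t))\<^sup>2" by (simp add: power2_eq_square)
    also have "\<dots> \<le> a t / \<theta> * (norm (u t))\<^sup>2"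
      using a pos by (intro mult_right_mono divide_right_mono) auto
    finally show ?thesis by simp
  qed
  have "t powr (2 * q + s) * norm (z t) \<le> (sqrt (max ((norm (u T))\<^sup>2) (M\<^sup>2)) + K) / \<theta>" if t: "t \<ge> T" for t
  proof -
    have "(norm (u t))\<^sup>2 \<le> max ((norm (u T))\<^sup>2) (M\<^sup>2)"
      by (rule deriv_nonpos_above_imp_bounded[OF has_real_derivative_norm_square[OF du] decr t])
    hence "norm (u t) \<le> sqrt (max ((norm (u T))\<^sup>2) (M\<^sup>2))" by (rule real_le_rsqrt)
    moreover have "\<theta> * (t powr (2 * q + s) * norm (z t)) = norm (u t + l t)"
      using pos by (simp add: u_def abs_mult)
    moreover have "norm (u t + l t) \<le> norm (u t) + K" using norm_triangle_ineq[of "u t" "l t"] K[OF t] by linarith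
    ultimately show ?thesis using pos by (simp add: field_simps)
  qed
  thus ?thesis unfolding z_def by blast
qed

section \<open>Asymptotic estimates and conclusion\<close>

lemma eventually_powr_neg_le:
  fixes k d a :: real
  assumes "d < 0" "a > 0"
  shows "eventually (\<lambda>t. k * t powr d \<le> a) at_top"
proof -
  have "((\<lambda>t. k * t powr d) \<longlongrightarrow> k * 0) at_top"
    by (intro tendsto_mult tendsto_const tendsto_neg_powr assms filterlim_ident)
  from order_tendstoD(2)[OF this, of a] assms show ?thesis
    by (auto elim: eventually_mono)
qed

lemma le_bigo_powrI:
  assumes "\<And>t. t \<ge> T \<Longrightarrow> t powr d * g t \<le> C" "T \<ge> t0" "T > 0"
  shows "le_bigo t0 g (\<lambda>t. 1 / t powr d)"
  unfolding le_bigo_def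
proof (intro exI conjI allI impI)
  fix t assume t: "T \<le> t"
  hence "t powr d > 0" using assms(3) by simp
  \<comment> \<open>\<open>le_bigo\<close> asks for a positive constant, hence the maximum with
    1.\<close>
  moreover have "t powr d * g t \<le> max C 1" using assms(1)[OF t] by simp
  ultimately show "g t \<le> max C 1 * (1 / t powr d)" by (simp add: field_simps)
qed (use assms in auto)

theorem theorem3p3:
  fixes f :: "'a::{real_inner, complete_space} \<Rightarrow> real"
    and gf :: "'a \<Rightarrow> 'a"
    and A :: "'a \<Rightarrow> 'b::{real_inner, complete_space}"
    and b :: 'b
    and t0 \<alpha> \<theta> q p c s :: real
    and x :: "real \<Rightarrow> 'a" and l :: "real \<Rightarrow> 'b"
    and xs :: 'a and ls :: 'b
  assumes "convex_on UNIV f"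
    and "\<And>z. GDERIV f z :> gf z"
    and "continuous_on UNIV gf"
    and "bounded_linear A"
    and "saddle_points f A b \<noteq> {}"
    and "t0 > 0" and "\<alpha> > 0" and "\<theta> > 1 / \<alpha>"
    and "0 \<le> q" and "q < 1" and "0 < p" and "p < 1 - q" and "c > 0"
    and "- 2 * q < s" and "s \<le> p - 2 * q"
    and "solves_system gf A b \<alpha> \<theta> q p c s t0 x l"
    and "is_arg_min norm (\<lambda>z. z \<in> saddle_points f A b) (xs, ls)"
  shows "le_bigo t0 (\<lambda>t. lagrangian f A b (x t) ls - lagrangian f A b xs ls)
           (\<lambda>t. 1 / t powr (2 * q + s))
       \<and> le_bigo t0 (\<lambda>t. \<bar>f (x t) - f xs\<bar>) (\<lambda>t. 1 / t powr (2 * q + s))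
       \<and> le_bigo t0 (\<lambda>t. norm (A (x t) - b)) (\<lambda>t. 1 / t powr (2 * q + s))"
proof -
  interpret A: bounded_linear A by fact
  have saddle: "(xs, ls) \<in> saddle_points f A b"
    using assms(17) by (simp add: is_arg_min_def)
  have b: "b = A xs" using saddle_point_feasible[OF saddle] by simp
  define \<phi> where "\<phi> = (\<lambda>z. lagrangian f A b z ls - lagrangian f A b xs ls)"
  have \<phi>: "\<phi> z = f z - f xs + ls \<bullet> (A z - A xs)" for z
    by (simp add: \<phi>_def lagrangian_def b)
  have adj: "A u \<bullet> v = u \<bullet> adjoint A v" for u v
    by (rule adjoint_bounded_linear_works[OF assms(4)])
  have \<phi>0: "\<phi> z \<ge> 0" for z
    using saddle_point_minimal[OF saddle] by (simp add: \<phi>_def)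
  have gd: "GDERIV \<phi> z :> gf z + adjoint A ls" for z
  proof -
    have "((\<lambda>z. ls \<bullet> (A z - A xs)) has_derivative (\<lambda>h. ls \<bullet> (A h - 0))) (at z)"
      by (intro derivative_intros A.has_derivative)
    hence "GDERIV (\<lambda>z. ls \<bullet> (A z - A xs)) z :> adjoint A ls"
      by (simp add: gderiv_def inner_commute[of ls] adj)
    from GDERIV_add[OF GDERIV_diff[OF assms(2) GDERIV_const[of "f xs"]] this] show ?thesis
      unfolding \<phi> by simp
  qed
  have tangent: "(z - xs) \<bullet> (gf z + adjoint A ls) \<ge> \<phi> z" for z
  proof -
    have "ls \<bullet> (A z - A xs) = (z - xs) \<bullet> adjoint A ls"
      by (simp add: adj[symmetric] A.diff inner_commute)
    moreover have "(xs - z) \<bullet> gf z = - ((z - xs) \<bullet> gf z)" by (simp add: inner_simps)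
    ultimately show ?thesis
      using convex_gderiv_tangent[OF assms(1,2), of xs z] by (simp add: \<phi> inner_add_right)
  qed
  have \<theta>: "\<theta> > 0" using assms(7,8) by (smt (verit) divide_pos_pos)
  \<comment> \<open>Half of the positive margin in \<open>\<theta> * \<alpha> > 1\<close>; the other
    half absorbs the time-dependent part of the weight \<open>k\<close>.\<close>
  define \<kappa> where "\<kappa> = (\<theta> * \<alpha> - 1) / 2"
  have \<kappa>: "\<kappa> > 0" "\<theta> * \<alpha> = 1 + 2 * \<kappa>" using assms(7,8) by (simp_all add: \<kappa>_def field_simps)
  \<comment> \<open>All exponents are negative: \<open>q < 1\<close>, and
    \<open>p - s < p + 2 * q < 1 + q < 2\<close>. The strict bound \<open>t > t0\<close> makes the
    one-sided derivatives two-sided.\<close>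
  have "eventually (\<lambda>t. 2 * \<theta> * (2 * q + s) * t powr (q - 1) \<le> 1 \<and> \<theta> * q * t powr (q - 1) \<le> \<kappa>
      \<and> 2 * q * (1 - q) * t powr (p - s - 2) \<le> c \<and> t > t0 \<and> t \<ge> 1) at_top"
    using assms \<kappa> by (intro eventually_conj eventually_powr_neg_le eventually_gt_at_top eventually_ge_at_top) auto
  then obtain T where T: "\<And>t. t \<ge> T \<Longrightarrow> 2 * \<theta> * (2 * q + s) * t powr (q - 1) \<le> 1"
      "\<And>t. t \<ge> T \<Longrightarrow> \<theta> * q * t powr (q - 1) \<le> \<kappa>"
      "\<And>t. t \<ge> T \<Longrightarrow> 2 * q * (1 - q) * t powr (p - s - 2) \<le> c"
      "\<And>t. t \<ge> T \<Longrightarrow> t > t0" "T \<ge> 1"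
    unfolding eventually_at_top_linorder by auto
  obtain x' x'' l' where sol: "\<And>t. t \<ge> t0 \<Longrightarrow>
       (x has_vector_derivative x' t) (at t within {t0..}) \<and>
       (x' has_vector_derivative x'' t) (at t within {t0..}) \<and>
       (l has_vector_derivative l' t) (at t within {t0..}) \<and>
       x'' t + (\<alpha> / t powr q) *\<^sub>R x' t
         + (t powr s) *\<^sub>R (gf (x t) + adjoint A (l t) + (c / t powr p) *\<^sub>R x t) = 0 \<and>
       l' t - (t powr (q + s)) *\<^sub>R
         (A (x t + (\<theta> * t powr q) *\<^sub>R x' t) - b - (c / t powr p) *\<^sub>R l t) = 0"
    using assms(16) unfolding solves_system_def by blast
  have at: "at t within {t0..} = at t" if "t \<ge> T" for t
    using T(4)[OF that] by (intro at_within_interior) simp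
  have dx: "(x has_vector_derivative x' t) (at t)" if "t \<ge> T" for t
    using sol[of t] T(4)[OF that] at[OF that] by simp
  have dx': "(x' has_vector_derivative - (\<alpha> / t powr q) *\<^sub>R x' t
      - (t powr s) *\<^sub>R (gf (x t) + adjoint A (l t) + (c / t powr p) *\<^sub>R x t)) (at t)" if "t \<ge> T" for t
  proof -
    have eq: "X = - P - Q" if "X + P + Q = 0" for X P Q :: 'a
    proof -
      have "X = (X + P + Q) - P - Q" by simp
      thus ?thesis by (simp add: that)
    qed
    have "x'' t = - ((\<alpha> / t powr q) *\<^sub>R x' t)
      - (t powr s) *\<^sub>R (gf (x t) + adjoint A (l t) + (c / t powr p) *\<^sub>R x t)"
      by (rule eq) (use sol[of t] T(4)[OF that] in simp)
    thus ?thesis using sol[of t] T(4)[OF that] at[OF that] by simp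
  qed
  have dl: "(l has_vector_derivative (t powr (q + s)) *\<^sub>R
      (A (x t + (\<theta> * t powr q) *\<^sub>R x' t) - A xs - (c / t powr p) *\<^sub>R l t)) (at t)" if "t \<ge> T" for t
    using sol[of t] T(4)[OF that] at[OF that] by (auto simp: b)
  obtain K where K: "\<And>t. t \<ge> T \<Longrightarrow> t powr (2 * q + s) * \<phi> (x t) \<le> K" "\<And>t. t \<ge> T \<Longrightarrow> norm (l t) \<le> K"
    using trajectory_bounded[OF A.linear adj gd \<phi>0 tangent \<theta> assms(13) \<kappa> assms(9,10,15) T(5,1-3) dx dx' dl]
    by blast
  obtain C where C: "\<And>t. t \<ge> T \<Longrightarrow> t powr (2 * q + s) * norm (A (x t) - A xs) \<le> C"
    using feasibility_bounded[OF assms(4) \<theta> assms(13) _ assms(15) T(5,1) dx dl K(2)] assms(14) by auto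
  \<comment> \<open>The objective gap differs from the Lagrangian gap only by the pairing of
    \<open>ls\<close> with the residual, so both rates already obtained combine.\<close>
  have "t powr (2 * q + s) * \<bar>f (x t) - f xs\<bar> \<le> K + norm ls * C" if t: "t \<ge> T" for t
  proof -
    have "\<bar>ls \<bullet> (A (x t) - A xs)\<bar> \<le> norm ls * norm (A (x t) - A xs)"
      by (rule Cauchy_Schwarz_ineq2)
    hence "\<bar>f (x t) - f xs\<bar> \<le> \<phi> (x t) + norm ls * norm (A (x t) - A xs)"
      using \<phi>[of "x t"] \<phi>0[of "x t"] by linarith
    hence "t powr (2 * q + s) * \<bar>f (x t) - f xs\<bar>
        \<le> t powr (2 * q + s) * (\<phi> (x t) + norm ls * norm (A (x t) - A xs))"
      by (intro mult_left_mono) auto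
    also have "\<dots> \<le> K + norm ls * C"
      using K(1)[OF t] mult_left_mono[OF C[OF t], of "norm ls"] by (simp add: algebra_simps)
    finally show ?thesis .
  qed
  moreover have "T \<ge> t0" "T > 0" using T(4)[of T] T(5) by simp_all
  ultimately show ?thesis
    using K(1) C unfolding \<phi>_def b[symmetric] by (intro conjI le_bigo_powrI) blast+
qed

end
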